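(* Suppose $(\theta_{12},\theta_{13},\theta_{14},\theta_{23},\theta_{24},\theta_{34})$ is a $6$-tuple of numbers in $[0,\pi]$. Then the following statements are equivalent. (1) $(\theta_{12},\dots,\theta_{34})$ is the set of dihedral angles of a generalized hyperbolic tetrahedron. (2) The Gram matrix $G$ of $(\theta_{12},\dots,\theta_{34})$ has signature $(3,1)$.
   Context: The Gram matrix of $(\theta_{12},\dots,\theta_{34})$ is the symmetric $4\times4$ matrix with diagonal entries $1$ and $(i,j)$ entry $-\cos\theta_{ij}$ for $i\ne j$. Signature $(p,q)$ means $p$ positive and $q$ negative eigenvalues. Let $\mathbb E^{3,1}$ be $\mathbb R^4$ with $\langle\mathbf x,\mathbf y\rangle=x_1y_1+x_2y_2+x_3y_3-x_4y_4$, and $\mathbb S(c)=\{\mathbf v:\langle\mathbf v,\mathbf v\rangle=c\}$ for $c\in\{-1,0,1\}$. A generalized hyperbolic tetrahedron is a quadruple of linearly independent vectors $\mathbf v_1,\dots,\mathbf v_4\in\mathbb S(-1)\cup\mathbb S(0)\cup\mathbb S(1)$ such that for each pair $\{i,j\}$ the straight line $L_{ij}$ through $\mathbf v_i$ and $\mathbf v_j$ meets $\{\mathbf v:\langle\mathbf v,\mathbf v\rangle\leqslant0\}$; this is understood projectively, i.e. the projective line through the images of $\mathbf v_i,\mathbf v_j$ in projective space meets the closed ball $\overline{\mathbb H^3}$ (the image of the nonzero vectors with $\langle\mathbf v,\mathbf v\rangle\leqslant0$), equivalently $\mathrm{span}(\mathbf v_i,\mathbf v_j)$ contains a nonzero vector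 $\mathbf v$ with $\langle\mathbf v,\mathbf v\rangle\leqslant0$. For each $i$, the outward normal vector $\mathbf u_i$ of the face opposite to $\mathbf v_i$ is the unique vector in $\mathbb S(1)$ with $\langle\mathbf u_i,\mathbf v_j\rangle=0$ for all $j\neq i$ and $\langle\mathbf u_i,\mathbf v_i\rangle<0$. The dihedral angles are $\theta_{ij}=\pi-\cos^{-1}\langle\mathbf u_i,\mathbf u_j\rangle$. *)

theory Defs
  imports "HOL-Analysis.Analysis" "HOL-Computational_Algebra.Polynomial"
begin

definition lorentz :: "real ^ 4 \<Rightarrow> real ^ 4 \<Rightarrow> real" where
  "lorentz x y = x $ 1 * y $ 1 + x $ 2 * y $ 2 + x $ 3 * y $ 3 - x $ 4 * y $ 4"

definition pseudosphere :: "real \<Rightarrow> (real ^ 4) set" where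
  "pseudosphere c = {v. lorentz v v = c}"

text \<open>
  The lines of a generalized hyperbolic tetrahedron are projective lines: the line through the
  images of two independent vectors meets the closed ball iff their span contains a nonzero
  vector that is timelike or null. Linear independence of the quadruple needs injectivity, since
  \<^const>\<open>range\<close> forgets repetitions.
\<close>

definition generalized_hyperbolic_tetrahedron :: "(4 \<Rightarrow> real ^ 4) \<Rightarrow> bool" where
  "generalized_hyperbolic_tetrahedron v \<longleftrightarrow>
     inj v \<and> independent (range v) \<and>
     (\<forall>i. v i \<in> pseudosphere (-1) \<union> pseudosphere 0 \<union> pseudosphere 1) \<and>
     (\<forall>i j. i \<noteq> j \<longrightarrow> (\<exists>x \<in> span {v i, v j}. x \<noteq> 0 \<and> lorentz x x \<le> 0))"

definition outward_normal :: "(4 \<Rightarrow> real ^ 4) \<Rightarrow> 4 \<Rightarrow> real ^ 4" where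
  "outward_normal v i =
     (THE u. u \<in> pseudosphere 1 \<and> (\<forall>j. j \<noteq> i \<longrightarrow> lorentz u (v j) = 0) \<and> lorentz u (v i) < 0)"

definition dihedral_angle :: "(4 \<Rightarrow> real ^ 4) \<Rightarrow> 4 \<Rightarrow> 4 \<Rightarrow> real" where
  "dihedral_angle v i j = pi - arccos (lorentz (outward_normal v i) (outward_normal v j))"

text \<open>
  A 6-tuple of angles is a symmetric family indexed by pairs of distinct indices;
  its diagonal values are irrelevant.
\<close>

definition gram_matrix :: "(4 \<Rightarrow> 4 \<Rightarrow> real) \<Rightarrow> real ^ 4 ^ 4" where
  "gram_matrix \<theta> = (\<chi> i j. if i = j then 1 else - cos (\<theta> i j))"

definition charpoly :: "real ^ 'n ^ 'n \<Rightarrow> real poly" where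
  "charpoly A = det (mat [:0, 1:] - (\<chi> i j. [:A $ i $ j:]))"

text \<open>The numbers of positive and of negative eigenvalues, counted with multiplicity.\<close>

definition signature :: "real ^ 'n ^ 'n \<Rightarrow> nat \<times> nat" where
  "signature A =
     (\<Sum>x | poly (charpoly A) x = 0 \<and> x > 0. order x (charpoly A),
      \<Sum>x | poly (charpoly A) x = 0 \<and> x < 0. order x (charpoly A))"

end

theory Submission
  imports Defs
begin

text \<open>
  The outward normals are a rescaled dual basis of the vertices for the Lorentz form. A causal
  vector in the span of two vertices is orthogonal to the two opposite normals, and the orthogonal
  complement of a causal vector is positive semidefinite; this bounds the product of these normals
  by 1, so the Gram matrix of the angles is the Lorentz Gram matrix of a basis and has signature
  $(3,1)$ by Sylvester's law. Likewise a normal cannot fail to be spacelike: it would then be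
  parallel to the causal vectors on all three edges of its face.
  Conversely, the spectral theorem realises a matrix of signature $(3,1)$ as the Lorentz Gram matrix
  of a basis, whose rescaled dual basis is the tetrahedron; since the entries of the matrix are
  bounded by 1, the complement of two of the basis vectors contains a causal vector.
\<close>

section \<open>Spectral theorem and signature\<close>

text \<open>The unit vector of the subspace that maximises the Rayleigh quotient is an eigenvector.\<close>

lemma exists_eigenvector_in_subspace:
  fixes f :: "'a::euclidean_space \<Rightarrow> 'a"
  assumes "linear f" and self_adj: "\<And>x y. x \<bullet> f y = f x \<bullet> y"
    and S: "subspace S" "S \<noteq> {0}" and inv: "f ` S \<subseteq> S"
  obtains x c where "x \<in> S" "norm x = 1" "f x = c *\<^sub>R x"
proof -
  interpret linear f by fact
  obtain y where y: "y \<in> S" "y \<noteq> 0"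
    using S subspace_0 by blast
  let ?K = "S \<inter> sphere 0 1"
  have "y /\<^sub>R norm y \<in> ?K"
    using y S by (auto simp: subspace_scale)
  moreover have "compact ?K"
    using S(1) closed_subspace compact_sphere by blast
  moreover have "continuous_on ?K (\<lambda>x. x \<bullet> f x)"
    using \<open>linear f\<close> by (intro continuous_intros linear_continuous_on linear_linear[THEN iffD1])
      (auto simp: linear_conv_bounded_linear)
  ultimately obtain x where x: "x \<in> ?K" and max: "\<And>z. z \<in> ?K \<Longrightarrow> z \<bullet> f z \<le> x \<bullet> f x"
    using continuous_attains_sup[of ?K "\<lambda>x. x \<bullet> f x"] by blast
  define c where "c = x \<bullet> f x"
  have norm_x: "norm x = 1" "x \<in> S" and xx: "x \<bullet> x = 1"
    using x by (auto simp: norm_eq_1)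
  have nonneg: "0 \<le> c * (z \<bullet> z) - z \<bullet> f z" if "z \<in> S" for z
  proof (cases "z = 0")
    case False
    have "(z /\<^sub>R norm z) \<bullet> f (z /\<^sub>R norm z) \<le> c"
      unfolding c_def using that False S(1) by (intro max) (auto simp: subspace_scale)
    also have "(z /\<^sub>R norm z) \<bullet> f (z /\<^sub>R norm z) = (z \<bullet> f z) / (norm z)\<^sup>2"
      by (simp add: scale power2_eq_square divide_simps)
    finally show ?thesis
      using False by (simp add: divide_simps power2_norm_eq_inner mult.commute)
  qed (simp add: zero)
  \<comment> \<open>This is half the gradient at \<open>x\<close> of the form in
    \<open>nonneg\<close>, which has its minimum 0 there. Moving from \<open>x\<close> along
    \<open>w\<close> leaves a polynomial in the step without constant term, whose linear coefficient
    is twice the square of \<open>w\<close>.\<close>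
  define w where "w = c *\<^sub>R x - f x"
  have w: "w \<in> S"
    unfolding w_def using norm_x inv S(1) by (auto intro!: subspace_diff subspace_scale)
  define q where "q = c * (w \<bullet> w) - w \<bullet> f w"
  have quadratic: "0 \<le> 2 * t * (w \<bullet> w) + t\<^sup>2 * q" for t
  proof -
    have "0 \<le> c * ((x + t *\<^sub>R w) \<bullet> (x + t *\<^sub>R w)) - (x + t *\<^sub>R w) \<bullet> f (x + t *\<^sub>R w)"
      by (intro nonneg subspace_add subspace_scale S norm_x w)
    also have "\<dots> = 2 * t * (w \<bullet> w) + t\<^sup>2 * q"
    proof -
      have "x \<bullet> f w = f x \<bullet> w" by (rule self_adj)
      then have "2 * t * (w \<bullet> w) = 2 * t * (c * (x \<bullet> w)) - t * (x \<bullet> f w) - t * (f x \<bullet> w)"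
        by (simp add: w_def[THEN arg_cong, of "\<lambda>u. u \<bullet> w"] inner_diff_left algebra_simps)
      moreover have "c * (x \<bullet> x) = x \<bullet> f x" by (simp add: xx c_def)
      ultimately show ?thesis
        unfolding q_def
        by (simp add: add scale inner_add_left inner_add_right power2_eq_square
            inner_commute algebra_simps)
    qed
    finally show ?thesis .
  qed
  have "w \<bullet> w = 0"
  proof (rule ccontr)
    assume "w \<bullet> w \<noteq> 0"
    then have pos: "0 < w \<bullet> w" by (metis inner_ge_zero order_less_le)
    \<comment> \<open>A negative step so short that the quadratic term is at most half of the linear
      one; adding 1 keeps the denominator positive when \<open>q\<close> is 0.\<close>
    define t where "t = - (w \<bullet> w) / (\<bar>q\<bar> + 1)"
    have t: "t < 0" using pos by (simp add: t_def divide_neg_pos)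
    have "- t * \<bar>q\<bar> \<le> w \<bullet> w"
      using pos by (simp add: t_def divide_simps)
    then have "- t * (- t * \<bar>q\<bar>) \<le> - t * (w \<bullet> w)"
      using t by (intro mult_left_mono) auto
    moreover have "t\<^sup>2 * q \<le> t\<^sup>2 * \<bar>q\<bar>" by (intro mult_left_mono) auto
    ultimately have "t\<^sup>2 * q \<le> - t * (w \<bullet> w)" by (simp add: power2_eq_square)
    moreover have "t * (w \<bullet> w) < 0" using t pos by (simp add: mult_neg_pos)
    ultimately show False using quadratic[of t] by simp
  qed
  then have "f x = c *\<^sub>R x" by (simp add: w_def)
  with norm_x that show thesis by blast
qed

text \<open>A set of any size, not yet a basis: the basis arises as such a set of greatest
  cardinality.\<close>

definition orthonormal_eigenvectors :: "('a::euclidean_space \<Rightarrow> 'a) \<Rightarrow> 'a set \<Rightarrow> bool" where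
  "orthonormal_eigenvectors f B \<longleftrightarrow>
     pairwise orthogonal B \<and> (\<forall>x\<in>B. norm x = 1 \<and> (\<exists>c. f x = c *\<^sub>R x))"

lemma orthonormal_eigenvectors_independent:
  assumes "orthonormal_eigenvectors f B"
  shows "independent B"
  using assms pairwise_orthogonal_independent unfolding orthonormal_eigenvectors_def by force

text \<open>Independence bounds the size of such sets, so a largest one exists. If it were too
  small, its orthogonal complement would be a nonzero invariant subspace and would supply one more
  unit eigenvector.\<close>

lemma self_adjoint_eigenbasis:
  fixes f :: "'a::euclidean_space \<Rightarrow> 'a"
  assumes "linear f" and self_adj: "\<And>x y. x \<bullet> f y = f x \<bullet> y"
  obtains B where "orthonormal_eigenvectors f B" "card B = DIM('a)"
proof -
  have "card B \<le> DIM('a)" if "orthonormal_eigenvectors f B" for B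
    using orthonormal_eigenvectors_independent[OF that] independent_bound by blast
  moreover have "orthonormal_eigenvectors f {}"
    by (simp add: orthonormal_eigenvectors_def)
  ultimately obtain B where B: "orthonormal_eigenvectors f B"
    and max: "\<And>C. orthonormal_eigenvectors f C \<Longrightarrow> card C \<le> card B"
    using ex_has_greatest_nat[of "orthonormal_eigenvectors f" "{}" card "Suc (DIM('a))"]
    by (auto simp: less_Suc_eq_le)
  have indep: "independent B" using B by (rule orthonormal_eigenvectors_independent)
  have "card B = DIM('a)"
  proof (rule ccontr)
    assume "card B \<noteq> DIM('a)"
    then have "dim B < DIM('a)"
      using indep independent_bound dim_eq_card_independent[OF indep] by force
    then obtain y where y: "y \<noteq> 0" "\<And>b. b \<in> span B \<Longrightarrow> orthogonal y b"
      by (rule orthogonal_to_subspace_exists) blast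
    define S where "S = {x. \<forall>b\<in>B. orthogonal b x}"
    have S: "subspace S"
      unfolding S_def by (rule subspace_orthogonal_to_vectors)
    have "y \<in> S" using y by (auto simp: S_def orthogonal_commute span_base)
    then have "S \<noteq> {0}" using y by auto
    moreover have "f ` S \<subseteq> S"
    proof clarify
      fix x assume x: "x \<in> S"
      have "orthogonal b (f x)" if "b \<in> B" for b
      proof -
        have "\<exists>c. f b = c *\<^sub>R b"
          using B that by (simp add: orthonormal_eigenvectors_def)
        then obtain c where "f b = c *\<^sub>R b" ..
        then show ?thesis
          using x that self_adj[of b x] by (auto simp: S_def orthogonal_def)
      qed
      then show "f x \<in> S" by (simp add: S_def)
    qed
    ultimately obtain x c where x: "x \<in> S" "norm x = 1" "f x = c *\<^sub>R x"
      using exists_eigenvector_in_subspace[OF assms S] by blast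
    have "x \<notin> B"
      using x by (auto simp: S_def orthogonal_def norm_eq_1)
    moreover have "orthonormal_eigenvectors f (insert x B)"
      using B x unfolding orthonormal_eigenvectors_def S_def
      by (auto simp: pairwise_insert orthogonal_commute)
    moreover have "finite B" using indep by (rule independent_imp_finite)
    ultimately show False using max[of "insert x B"] by simp
  qed
  with B that show thesis by blast
qed

lemma symmetric_matrix_eigenbasis:
  fixes A :: "real^'n^'n"
  assumes sym: "transpose A = A"
  shows "\<exists>(p :: 'n \<Rightarrow> real^'n) d. (\<forall>i j. p i \<bullet> p j = (if i = j then 1 else 0)) \<and>
    (\<forall>i. A *v p i = d i *\<^sub>R p i)"
proof -
  have "x \<bullet> (A *v y) = (A *v x) \<bullet> y" for x y
    by (metis dot_lmul_matrix sym vector_transpose_matrix)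
  then obtain B where B: "orthonormal_eigenvectors ((*v) A) B" "card B = CARD('n)"
    using self_adjoint_eigenbasis[of "(*v) A"] by auto
  have "finite B" using B(2) by (metis card.infinite zero_less_card_finite less_irrefl)
  then obtain p :: "'n \<Rightarrow> real^'n" where p: "bij_betw p UNIV B"
    using B(2) finite_same_card_bij[of "UNIV::'n set" B] by auto
  have pB: "p i \<in> B" for i using p by (auto simp: bij_betw_def)
  then have "\<forall>i. \<exists>c. A *v p i = c *\<^sub>R p i"
    using B(1) by (auto simp: orthonormal_eigenvectors_def)
  then obtain d where "\<And>i. A *v p i = d i *\<^sub>R p i" by metis
  moreover have "p i \<bullet> p j = (if i = j then 1 else 0)" for i j
  proof -
    have "p i \<noteq> p j" if "i \<noteq> j"
      using p that by (auto simp: bij_betw_def inj_def)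
    then show ?thesis
      using B(1) pB[of i] pB[of j]
      by (auto simp: orthonormal_eigenvectors_def pairwise_def orthogonal_def norm_eq_1)
  qed
  ultimately show ?thesis by (intro exI[of _ p] exI[of _ d]) simp
qed

section \<open>Characteristic polynomial and multiplicities of a diagonalised matrix\<close>

definition const_poly_matrix :: "real^'n^'m \<Rightarrow> real poly^'n^'m" where
  "const_poly_matrix A = (\<chi> i j. [:A $ i $ j:])"

lemma const_poly_sum: "[:sum f S:] = (\<Sum>i\<in>S. [:f i:])"
proof (induction S rule: infinite_finite_induct)
  case (insert x F)
  have "[:f x + sum f F:] = [:f x:] + [:sum f F:]" by simp
  with insert show ?case by (simp del: add_pCons)
qed auto

lemma const_poly_matrix_mult:
  "const_poly_matrix (A ** B) = const_poly_matrix A ** const_poly_matrix B"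
  by (simp add: const_poly_matrix_def matrix_matrix_mult_def vec_eq_iff const_poly_sum mult.commute)

lemma const_poly_matrix_mat: "const_poly_matrix (mat c) = mat [:c:]"
  by (simp add: const_poly_matrix_def mat_def vec_eq_iff)

text \<open>The scalar matrix X commutes with \<open>P\<close>, so X - A times \<open>P\<close>
  equals \<open>P\<close> times X - D. Taking determinants and cancelling that of \<open>P\<close>,
  which is nonzero because of \<open>Q\<close>, leaves the claim.\<close>

lemma charpoly_conjugate:
  fixes A D P Q :: "real^'n^'n"
  assumes AP: "A ** P = P ** D" and QP: "Q ** P = mat 1"
  shows "charpoly A = charpoly D"
proof -
  let ?C = const_poly_matrix and ?X = "mat [:0, 1:] :: real poly^'n^'n"
  have "(?X - ?C A) ** ?C P = ?X ** ?C P - ?C A ** ?C P"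
    by (simp add: matrix_matrix_mult_def vec_eq_iff sum_subtractf algebra_simps)
  also have "?X ** ?C P = ?C P ** ?X"
    by (simp add: matrix_matrix_mult_def vec_eq_iff mat_def if_distrib[of "\<lambda>x. x * _"]
        if_distrib[of "\<lambda>x. _ * x"] cong: if_cong)
  also have "?C P ** ?X - ?C A ** ?C P = ?C P ** (?X - ?C D)"
    unfolding const_poly_matrix_mult[symmetric] AP
    unfolding const_poly_matrix_mult
    by (simp add: matrix_matrix_mult_def vec_eq_iff sum_subtractf algebra_simps)
  finally have "charpoly A * det (?C P) = det (?C P) * charpoly D"
    by (metis charpoly_def const_poly_matrix_def det_mul)
  moreover have "det (?C Q) * det (?C P) = 1"
    by (metis det_mul const_poly_matrix_mult QP const_poly_matrix_mat one_pCons det_I)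
  ultimately show ?thesis by (metis mult.commute mult_cancel_left mult_zero_right zero_neq_one)
qed

lemma charpoly_eigenbasis:
  fixes A :: "real^'n^'n" and p :: "'n \<Rightarrow> real^'n"
  assumes orth: "\<And>i j. p i \<bullet> p j = (if i = j then 1 else 0)"
    and eig: "\<And>i. A *v p i = d i *\<^sub>R p i"
  shows "charpoly A = (\<Prod>i\<in>UNIV. [:- d i, 1:])"
proof -
  define P D :: "real^'n^'n" where "P = (\<chi> i j. p j $ i)"
    and "D = (\<chi> i j. if i = j then d i else 0)"
  have "A ** P = P ** D"
  proof -
    have "(\<Sum>k\<in>UNIV. A $ i $ k * p j $ k) = d j * p j $ i" for i j
      using eig[of j] by (simp add: vec_eq_iff matrix_vector_mult_def)
    then show ?thesis
      by (simp add: P_def D_def vec_eq_iff matrix_matrix_mult_def if_distrib cong: if_cong)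
  qed
  moreover have "transpose P ** P = mat 1"
    using orth by (simp add: P_def vec_eq_iff matrix_matrix_mult_def transpose_def mat_def
        inner_vec_def)
  ultimately have "charpoly A = charpoly D" by (rule charpoly_conjugate)
  also have "\<dots> = (\<Prod>i\<in>UNIV. [:- d i, 1:])"
    unfolding charpoly_def by (subst det_diagonal) (auto simp: D_def mat_def)
  finally show ?thesis .
qed

text \<open>Orders add up over nonzero factors, and each linear factor contributes 1 exactly at its
  own root.\<close>

lemma order_prod_linear:
  assumes "finite S"
  shows "order x (\<Prod>i\<in>S. [:- d i, 1:]) = card {i \<in> S. d i = x}"
  using assms
proof induction
  case (insert k S)
  have "order x [:- d k, 1:] = (if d k = x then 1 else 0)"
    using order_power_n_n[of x 1] by (auto intro: order_0I)
  moreover have "{i \<in> insert k S. d i = x} = (if d k = x then {k} else {}) \<union> {i \<in> S. d i = x}"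
    by auto
  ultimately show ?case
    using insert.hyps insert.IH unfolding prod.insert[OF insert.hyps]
    by (subst order_mult) (auto simp: card_insert_if prod_zero_iff simp del: mult_pCons_left)
qed simp

text \<open>A one-sided inverse of a square matrix is two-sided. The result is the completeness
  relation by which vectors and matrices are expanded in the eigenbasis.\<close>

lemma orthonormal_rows_columns:
  fixes p :: "'n::finite \<Rightarrow> real^'n"
  assumes "\<And>i j. p i \<bullet> p j = (if i = j then 1 else 0)"
  shows "(\<Sum>k\<in>UNIV. p k $ i * p k $ j) = (if i = j then 1 else 0)"
proof -
  define P :: "real^'n^'n" where "P = (\<chi> i. p i)"
  have "P ** transpose P = mat 1"
    using assms by (simp add: P_def vec_eq_iff matrix_matrix_mult_def transpose_def mat_def
        inner_vec_def)
  then have "transpose P ** P = mat 1" by (simp add: matrix_left_right_inverse)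
  then have "(transpose P ** P) $ i $ j = mat 1 $ i $ j" by simp
  then show ?thesis
    by (simp add: P_def matrix_matrix_mult_def transpose_def mat_def)
qed

text \<open>The order of an eigenvalue is the size of its fibre under \<open>d\<close>, and the
  fibres over the values of one sign add up to the count of indices.\<close>

lemma signature_eigenbasis:
  fixes A :: "real^'n^'n" and p :: "'n \<Rightarrow> real^'n"
  assumes "\<And>i j. p i \<bullet> p j = (if i = j then 1 else 0)"
    and "\<And>i. A *v p i = d i *\<^sub>R p i"
  shows "signature A = (card {i. 0 < d i}, card {i. d i < 0})"
proof -
  have cp: "charpoly A = (\<Prod>i\<in>UNIV. [:- d i, 1:])"
    using assms by (rule charpoly_eigenbasis)
  have count: "(\<Sum>x | poly (charpoly A) x = 0 \<and> R x. order x (charpoly A)) = card {i. R (d i)}"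
    for R
  proof -
    have "{x. poly (charpoly A) x = 0 \<and> R x} = d ` {i. R (d i)}"
      by (auto simp: cp poly_prod prod_zero_iff)
    then have "(\<Sum>x | poly (charpoly A) x = 0 \<and> R x. order x (charpoly A)) =
        (\<Sum>x \<in> d ` {i. R (d i)}. \<Sum>i | R (d i) \<and> d i = x. 1)"
      by (auto simp: cp order_prod_linear intro!: sum.cong arg_cong[of _ _ card])
    also have "\<dots> = card {i. R (d i)}"
      using sum.image_gen[of "{i. R (d i)}" "\<lambda>_. 1::nat" d] by simp
    finally show ?thesis .
  qed
  show ?thesis unfolding signature_def by (simp add: count)
qed

section \<open>Lorentz geometry\<close>

lemma lorentz_commute: "lorentz x y = lorentz y x"
  by (simp add: lorentz_def mult.commute)

lemma lorentz_bilinear [simp]: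
  "lorentz (x + y) z = lorentz x z + lorentz y z"
  "lorentz z (x + y) = lorentz z x + lorentz z y"
  "lorentz (x - y) z = lorentz x z - lorentz y z"
  "lorentz z (x - y) = lorentz z x - lorentz z y"
  "lorentz (a *\<^sub>R x) z = a * lorentz x z"
  "lorentz z (a *\<^sub>R x) = a * lorentz z x"
  "lorentz 0 z = 0"
  "lorentz z 0 = 0"
  by (simp_all add: lorentz_def algebra_simps)

lemma lorentz_sum_right: "lorentz z (sum f S) = (\<Sum>i\<in>S. lorentz z (f i))"
  by (induction S rule: infinite_finite_induct) auto

lemma lorentz_span_pair_eq_0:
  assumes "lorentz w a = 0" "lorentz w b = 0" "x \<in> span {a, b}"
  shows "lorentz w x = 0"
proof -
  have "span {a, b} \<subseteq> {x. lorentz w x = 0}"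
    using assms by (intro span_minimal) (auto simp: subspace_def)
  with assms show ?thesis by auto
qed

lemma causal_time_eq_0:
  assumes "x $ 4 = 0" "lorentz x x \<le> 0"
  shows "x = 0"
proof -
  have "x $ 1 * x $ 1 + x $ 2 * x $ 2 + x $ 3 * x $ 3 \<le> 0"
    using assms by (simp add: lorentz_def)
  moreover have "0 \<le> x $ 1 * x $ 1" "0 \<le> x $ 2 * x $ 2" "0 \<le> x $ 3 * x $ 3"
    by simp_all
  ultimately have "x $ 1 * x $ 1 = 0" "x $ 2 * x $ 2 = 0" "x $ 3 * x $ 3 = 0"
    by linarith+
  with assms(1) show ?thesis by (simp add: vec_eq_iff forall_4)
qed

text \<open>Subtracting the multiple of \<open>x\<close> that removes the time coordinate of
  \<open>y\<close> cannot increase the form, as \<open>x\<close> is causal and orthogonal to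
  \<open>y\<close>, while the result lies where the form is positive definite. If the form of
  \<open>y\<close> is nonpositive, the result must vanish.\<close>

lemma orthogonal_to_causal:
  assumes x: "x \<noteq> 0" "lorentz x x \<le> 0" and orth: "lorentz x y = 0"
  shows orthogonal_to_causal_nonneg: "0 \<le> lorentz y y"
    and orthogonal_to_causal_parallel: "lorentz y y \<le> 0 \<Longrightarrow> \<exists>t. y = t *\<^sub>R x"
proof -
  have "x $ 4 \<noteq> 0"
    using x causal_time_eq_0 by blast
  define t where "t = y $ 4 / x $ 4"
  define z where "z = y - t *\<^sub>R x"
  have z4: "z $ 4 = 0" using \<open>x $ 4 \<noteq> 0\<close> by (simp add: z_def t_def)
  then have z_nonneg: "0 \<le> lorentz z z" by (simp add: lorentz_def)
  have "lorentz z z = lorentz y y + t\<^sup>2 * lorentz x x"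
    using orth by (simp add: z_def lorentz_commute[of y x] power2_eq_square algebra_simps)
  moreover have "t\<^sup>2 * lorentz x x \<le> 0" using x by (simp add: mult_nonneg_nonpos)
  ultimately have le: "lorentz z z \<le> lorentz y y" by linarith
  with z_nonneg show "0 \<le> lorentz y y" by linarith
  assume "lorentz y y \<le> 0"
  with le have "lorentz z z \<le> 0" by linarith
  with z4 have "z = 0" by (rule causal_time_eq_0)
  then show "\<exists>t. y = t *\<^sub>R x" by (auto simp: z_def)
qed

text \<open>If the product is 1 in absolute value, a combination of \<open>a\<close> and
  \<open>b\<close> is itself null and orthogonal to both. Otherwise they span a positive definite
  plane, whose complement contains a timelike vector.\<close>

lemma exists_causal_orthogonal_to_pair:
  assumes unit: "lorentz a a = 1" "lorentz b b = 1" and le_1: "\<bar>lorentz a b\<bar> \<le> 1"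
    and indep: "\<And>t. a \<noteq> t *\<^sub>R b"
  obtains x where "x \<noteq> 0" "lorentz x x \<le> 0" "lorentz a x = 0" "lorentz b x = 0"
proof (cases "\<bar>lorentz a b\<bar> = 1")
  case True
  define c where "c = lorentz a b"
  have c: "c * c = 1" "lorentz a b = c" "lorentz b a = c"
    using True by (auto simp: c_def lorentz_commute abs_if split: if_splits)
  have "a - c *\<^sub>R b \<noteq> 0" using indep[of c] by simp
  moreover have "lorentz (a - c *\<^sub>R b) (a - c *\<^sub>R b) = 0" "lorentz a (a - c *\<^sub>R b) = 0"
    "lorentz b (a - c *\<^sub>R b) = 0"
    using unit c by simp_all
  ultimately show thesis using that by (metis order_refl)
next
  case False
  define c where "c = lorentz a b"
  define e :: "real^4" where "e = axis 4 1"
  define p q where "p = lorentz a e" and "q = lorentz b e"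
  define D where "D = 1 - c\<^sup>2"
  \<comment> \<open>\<open>x\<close> below is the projection of the timelike vector \<open>e\<close> along the positive definite span of \<open>a\<close>, \<open>b\<close>.\<close>
  have "\<bar>c\<bar> < 1" using False le_1 by (simp add: c_def)
  then have D: "D > 0" by (simp add: D_def abs_square_less_1)
  \<comment> \<open>These solve the two linear equations stating that \<open>x\<close> is orthogonal
    to \<open>a\<close> and \<open>b\<close>; \<open>D\<close> is the determinant of that
    system.\<close>
  define \<alpha> \<beta> where "\<alpha> = (p - c * q) / D" and "\<beta> = (q - c * p) / D"
  define x where "x = e - \<alpha> *\<^sub>R a - \<beta> *\<^sub>R b"
  have [simp]: "lorentz a b = c" "lorentz b a = c" "lorentz a e = p" "lorentz e a = p"
    "lorentz b e = q" "lorentz e b = q"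
    by (simp_all add: c_def p_def q_def lorentz_commute)
  have ee: "lorentz e e = -1" by (simp add: lorentz_def e_def axis_def)
  have ax: "lorentz a x = 0" and bx: "lorentz b x = 0"
    using D unit
    by (simp_all add: x_def \<alpha>_def \<beta>_def divide_simps) (simp_all add: D_def power2_eq_square algebra_simps)
  have "lorentz x x = lorentz e x - \<alpha> * lorentz a x - \<beta> * lorentz b x"
    by (subst (1) x_def) simp
  also have "\<dots> = -1 - (\<alpha> * p + \<beta> * q)"
    unfolding ax bx by (simp add: x_def ee)
  \<comment> \<open>Completing the square shows that this term is nonnegative, so the form of
    \<open>x\<close> is at most -1.\<close>
  also have "\<alpha> * p + \<beta> * q = ((p - c * q)\<^sup>2 + D * q\<^sup>2) / D"
    using D by (simp add: \<alpha>_def \<beta>_def divide_simps) (simp add: D_def power2_eq_square algebra_simps)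
  finally have "lorentz x x < 0"
    using D by (smt (verit) divide_nonneg_pos mult_nonneg_nonneg zero_le_power2)
  then show thesis using that[of x] ax bx by fastforce
qed

section \<open>Dual bases for the Lorentz form\<close>

lemma lorentz_dual_family:
  fixes u v :: "4 \<Rightarrow> real^4"
  assumes dual: "\<And>i j. lorentz (u i) (v j) = (if i = j then c i else 0)"
    and nz: "\<And>i. c i \<noteq> 0"
  shows lorentz_dual_inj: "inj v"
    and lorentz_dual_independent: "independent (range v)"
    and lorentz_dual_expansion: "x = (\<Sum>i\<in>UNIV. (lorentz (u i) x / c i) *\<^sub>R v i)"
proof -
  show inj: "inj v"
    by (rule injI) (metis dual nz)
  \<comment> \<open>Pairing with \<open>u i\<close> isolates the coefficient of \<open>v i\<close>;
    this gives independence and, once the span is known to be everything, the expansion.\<close>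
  have coeff: "lorentz (u i) (\<Sum>j\<in>UNIV. a j *\<^sub>R v j) = a i * c i" for a i
    by (simp add: lorentz_sum_right dual if_distrib cong: if_cong)
  have reindex: "(\<Sum>y\<in>range v. a y *\<^sub>R y) = (\<Sum>j\<in>UNIV. a (v j) *\<^sub>R v j)" for a
    using inj by (simp add: sum.reindex)
  show indep: "independent (range v)"
    unfolding independent_explicit
  proof (intro conjI allI impI)
    fix a assume "(\<Sum>y\<in>range v. a y *\<^sub>R y) = 0"
    then have "a (v i) * c i = 0" for i
      using coeff[of i "\<lambda>j. a (v j)"] by (simp add: reindex)
    then show "\<forall>y\<in>range v. a y = 0" using nz by auto
  qed simp
  have "card (range v) = 4" using inj by (simp add: card_image)
  then have "UNIV \<subseteq> span (range v)"
    using indep by (intro card_ge_dim_independent) auto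
  then obtain a where "x = (\<Sum>y\<in>range v. a y *\<^sub>R y)"
    using span_finite[of "range v"] by auto
  then have x: "x = (\<Sum>j\<in>UNIV. a (v j) *\<^sub>R v j)" by (simp add: reindex)
  have "lorentz (u i) x / c i = a (v i)" for i
    using coeff[of i "\<lambda>j. a (v j)"] nz[of i] x by simp
  with x show "x = (\<Sum>i\<in>UNIV. (lorentz (u i) x / c i) *\<^sub>R v i)" by simp
qed

text \<open>Each functional of the dual basis is represented by a vector because the form is
  nondegenerate. The value -1 fits the sign convention of outward normals.\<close>

lemma exists_lorentz_dual:
  fixes v :: "4 \<Rightarrow> real^4"
  assumes "inj v" "independent (range v)"
  shows "\<exists>w. \<forall>i j. lorentz (w i) (v j) = (if i = j then -1 else 0)"
proof -
  have "\<exists>w. \<forall>j. lorentz w (v j) = (if i = j then -1 else 0)" for i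
  proof -
    obtain g :: "real^4 \<Rightarrow> real" where g: "linear g"
      "\<forall>y\<in>range v. g y = (if v i = y then -1 else 0)"
      using linear_independent_extend[OF assms(2), of "\<lambda>y. if v i = y then -1 else (0::real)"] by auto
    interpret g: linear g by fact
    \<comment> \<open>The sign flip in the time coordinate cancels the minus sign in
      \<open>lorentz\<close>.\<close>
    define w :: "real^4" where "w = (\<chi> k. (if k = 4 then -1 else 1) * g (axis k 1))"
    have "lorentz w y = g y" for y
    proof -
      have "g y = g (\<Sum>k\<in>UNIV. (y $ k) *\<^sub>R axis k 1)"
        using basis_expansion[of y] by (simp add: scalar_mult_eq_scaleR)
      then show ?thesis
        unfolding sum_4 by (simp add: g.add g.scale lorentz_def w_def mult.commute)
    qed
    moreover have "g (v j) = (if i = j then -1 else 0)" for j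
      using g(2) assms(1) by (simp add: inj_eq)
    ultimately show ?thesis by (intro exI[of _ w]) simp
  qed
  then show ?thesis by (intro choice allI)
qed

lemma ex_4: "(\<exists>i::4. P i) \<longleftrightarrow> P 1 \<or> P 2 \<or> P 3 \<or> P 4"
  using forall_4[of "\<lambda>i. \<not> P i"] by blast

text \<open>The case \<open>k = l\<close> is included because \<open>tetrahedron_normals\<close>
  also applies this to a repeated index.\<close>

lemma exists_two_others:
  fixes k l :: 4
  obtains i j where "i \<noteq> j" "i \<noteq> k" "i \<noteq> l" "j \<noteq> k" "j \<noteq> l"
proof -
  have "\<forall>k l. \<exists>i j::4. i \<noteq> j \<and> i \<noteq> k \<and> i \<noteq> l \<and> j \<noteq> k \<and> j \<noteq> l"
    unfolding forall_4 ex_4 by simp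
  then show thesis using that by metis
qed

lemma exists_complementary_pair:
  fixes k l :: 4
  assumes "k \<noteq> l"
  shows "\<exists>i j. i \<noteq> j \<and> UNIV = {i, j, k, l}"
proof -
  obtain i j where "i \<noteq> j" "i \<noteq> k" "i \<noteq> l" "j \<noteq> k" "j \<noteq> l"
    by (rule exists_two_others)
  moreover from this have "{i, j, k, l} = UNIV"
    using assms by (intro card_subset_eq) auto
  ultimately show ?thesis by metis
qed

text \<open>Up to scale the family \<open>u\<close> is the basis dual to \<open>v\<close>. Expanding
  a competitor in it leaves a multiple of \<open>u i\<close>, and length and sign force the factor
  1.\<close>

lemma outward_normal_eqI:
  fixes u v :: "4 \<Rightarrow> real^4"
  assumes dual: "\<And>i j. lorentz (u i) (v j) = (if i = j then - c i else 0)"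
    and pos: "\<And>i. 0 < c i" and unit: "lorentz (u i) (u i) = 1"
  shows "outward_normal v i = u i"
  unfolding outward_normal_def
proof (rule the_equality)
  show "u i \<in> pseudosphere 1 \<and> (\<forall>j. j \<noteq> i \<longrightarrow> lorentz (u i) (v j) = 0) \<and> lorentz (u i) (v i) < 0"
    using dual pos unit by (simp add: pseudosphere_def)
next
  fix x
  assume x: "x \<in> pseudosphere 1 \<and> (\<forall>j. j \<noteq> i \<longrightarrow> lorentz x (v j) = 0) \<and> lorentz x (v i) < 0"
  define t where "t = lorentz x (v i) / - c i"
  have "lorentz (v j) (u m) = (if j = m then - c j else 0)" for j m
    using dual[of m j] by (auto simp: lorentz_commute)
  then have "x = (\<Sum>j\<in>UNIV. (lorentz (v j) x / - c j) *\<^sub>R u j)"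
    using pos by (intro lorentz_dual_expansion) (auto simp: less_imp_neq[symmetric])
  also have "\<dots> = (\<Sum>j\<in>UNIV. if j = i then t *\<^sub>R u i else 0)"
    using x by (intro sum.cong) (auto simp: t_def lorentz_commute)
  finally have x_eq: "x = t *\<^sub>R u i" by simp
  have "0 < t" using x pos[of i] by (simp add: t_def divide_neg_pos)
  moreover have "t * t = 1" using x unit by (simp add: x_eq pseudosphere_def)
  ultimately have "t = 1" by (simp add: square_eq_1_iff)
  with x_eq show "x = u i" by simp
qed

section \<open>Tetrahedra and their normals\<close>

lemma tetrahedron_normals:
  assumes "generalized_hyperbolic_tetrahedron v"
  shows "\<exists>u c. (\<forall>i j. lorentz (u i) (v j) = (if i = j then - c i else 0)) \<and>
    (\<forall>i. 0 < c i) \<and> (\<forall>i. lorentz (u i) (u i) = 1) \<and>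
    (\<forall>i j. i \<noteq> j \<longrightarrow> \<bar>lorentz (u i) (u j)\<bar> \<le> 1)"
proof -
  have edge: "\<exists>x\<in>span {v i, v j}. x \<noteq> 0 \<and> lorentz x x \<le> 0" if "i \<noteq> j" for i j
    using assms that unfolding generalized_hyperbolic_tetrahedron_def by blast
  have "inj v" "independent (range v)"
    using assms unfolding generalized_hyperbolic_tetrahedron_def by blast+
  from exists_lorentz_dual[OF this]
  obtain w where "\<forall>i j. lorentz (w i) (v j) = (if i = j then -1 else 0)" ..
  note w = this[rule_format]
  have w_pos: "0 < lorentz (w i) (w i)" for i
  proof (rule ccontr)
    assume "\<not> 0 < lorentz (w i) (w i)"
    then have nonpos: "lorentz (w i) (w i) \<le> 0" by simp
    \<comment> \<open>An edge avoiding both \<open>i\<close> and \<open>m\<close> has a causal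
      vector orthogonal to \<open>w i\<close> and \<open>w m\<close>. As \<open>w i\<close> is
      assumed not spacelike, it is a multiple of that vector, hence orthogonal to
      \<open>w m\<close>.\<close>
    have orth: "lorentz (w m) (w i) = 0" for m
    proof -
      obtain j k where jk: "j \<noteq> k" "j \<noteq> i" "j \<noteq> m" "k \<noteq> i" "k \<noteq> m"
        by (rule exists_two_others)
      obtain x where x: "x \<in> span {v j, v k}" "x \<noteq> 0" "lorentz x x \<le> 0"
        using edge[OF jk(1)] by blast
      have "lorentz (w i) x = 0" "lorentz (w m) x = 0"
        using jk w lorentz_span_pair_eq_0[OF _ _ x(1)] by simp_all
      moreover from this obtain t where "w i = t *\<^sub>R x"
        using orthogonal_to_causal_parallel[of x "w i"] x(2,3) nonpos lorentz_commute[of x "w i"] by auto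
      ultimately show ?thesis by simp
    qed
    have "w i = (\<Sum>j\<in>UNIV. (lorentz (w j) (w i) / -1) *\<^sub>R v j)"
      using w by (intro lorentz_dual_expansion) auto
    also have "\<dots> = 0" by (simp add: orth)
    finally have "w i = 0" .
    then show False using w[of i i] by simp
  qed
  define c where "c i = 1 / sqrt (lorentz (w i) (w i))" for i
  define u where "u i = c i *\<^sub>R w i" for i
  have c_pos: "0 < c i" for i using w_pos[of i] by (simp add: c_def)
  have dual: "lorentz (u i) (v j) = (if i = j then - c i else 0)" for i j
    by (simp add: u_def w)
  have unit: "lorentz (u i) (u i) = 1" for i
    using w_pos[of i] by (simp add: u_def c_def)
  have "\<bar>lorentz (u i) (u j)\<bar> \<le> 1" if "i \<noteq> j" for i j
  proof -
    obtain k l where kl: "k \<noteq> l" "k \<noteq> i" "k \<noteq> j" "l \<noteq> i" "l \<noteq> j"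
      by (rule exists_two_others)
    obtain x where x: "x \<in> span {v k, v l}" "x \<noteq> 0" "lorentz x x \<le> 0"
      using edge[OF kl(1)] by blast
    have "lorentz (u i) x = 0" "lorentz (u j) x = 0"
      using kl dual lorentz_span_pair_eq_0[OF _ _ x(1)] by simp_all
    \<comment> \<open>Both \<open>u i + u j\<close> and \<open>u i - u j\<close> are orthogonal to
      the causal vector \<open>x\<close>. Their squares are 2 plus or minus twice the product, which
      gives both bounds.\<close>
    then have "0 \<le> lorentz (u i + u j) (u i + u j)" "0 \<le> lorentz (u i - u j) (u i - u j)"
      using x(2,3) lorentz_commute[of x "u i"] lorentz_commute[of x "u j"]
      by (intro orthogonal_to_causal_nonneg[of x]; simp)+
    then show ?thesis by (simp add: unit lorentz_commute[of "u j" "u i"] abs_le_iff)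
  qed
  with dual c_pos unit show ?thesis by (intro exI[of _ u] exI[of _ c]) simp
qed

lemma tetrahedron_of_normals:
  assumes dual: "\<And>i j. lorentz (w i) (u j) = (if i = j then -1 else 0)"
    and unit: "\<And>i. lorentz (u i) (u i) = 1"
    and le_1: "\<And>i j. i \<noteq> j \<Longrightarrow> \<bar>lorentz (u i) (u j)\<bar> \<le> 1"
  obtains v where "generalized_hyperbolic_tetrahedron v" "\<And>i. outward_normal v i = u i"
proof -
  \<comment> \<open>A null vector cannot be normalised; any positive factor would serve, and 1 is
    taken.\<close>
  define c where
    "c i = (if lorentz (w i) (w i) = 0 then 1 else 1 / sqrt \<bar>lorentz (w i) (w i)\<bar>)" for i
  define v where "v i = c i *\<^sub>R w i" for i
  have c_pos: "0 < c i" for i by (simp add: c_def)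
  have uv: "lorentz (u i) (v j) = (if i = j then - c i else 0)" for i j
    using dual[of j i] by (auto simp: v_def lorentz_commute)
  have nz: "- c i \<noteq> 0" for i using c_pos[of i] by simp
  have "v i \<in> pseudosphere (-1) \<union> pseudosphere 0 \<union> pseudosphere 1" for i
  proof (cases "lorentz (w i) (w i)" "0::real" rule: linorder_cases)
    case less
    then show ?thesis
      by (simp add: pseudosphere_def v_def c_def abs_if real_sqrt_mult_self)
  next
    case equal
    then show ?thesis by (simp add: pseudosphere_def v_def)
  next
    case greater
    then show ?thesis by (simp add: pseudosphere_def v_def c_def)
  qed
  moreover have "\<exists>x\<in>span {v k, v l}. x \<noteq> 0 \<and> lorentz x x \<le> 0" if "k \<noteq> l" for k l
  proof -
    obtain i j where ij: "i \<noteq> j" "UNIV = {i, j, k, l}"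
      using exists_complementary_pair[OF \<open>k \<noteq> l\<close>] by metis
    \<comment> \<open>Pairing with \<open>w i\<close> gives -1 on the left and 0 on the
      right.\<close>
    have "u i \<noteq> t *\<^sub>R u j" for t
      using dual[of i i] dual[of i j] ij(1) by auto
    then obtain x where x: "x \<noteq> 0" "lorentz x x \<le> 0" "lorentz (u i) x = 0" "lorentz (u j) x = 0"
      using exists_causal_orthogonal_to_pair[of "u i" "u j"] unit le_1[OF ij(1)] by blast
    \<comment> \<open>The coefficients at \<open>i\<close> and \<open>j\<close> vanish, so only the
      vertices \<open>k\<close> and \<open>l\<close> remain.\<close>
    have "x = (\<Sum>m\<in>UNIV. (lorentz (u m) x / - c m) *\<^sub>R v m)"
      using uv nz by (rule lorentz_dual_expansion)
    also have "\<dots> \<in> span {v k, v l}"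
    proof (rule span_sum)
      fix m :: 4
      have "m = i \<or> m = j \<or> m = k \<or> m = l" using ij(2) by (metis UNIV_I insertE singletonD)
      then show "(lorentz (u m) x / - c m) *\<^sub>R v m \<in> span {v k, v l}"
      proof (elim disjE)
        assume "m = k" then show ?thesis by (intro span_scale span_base) simp
      next
        assume "m = l" then show ?thesis by (intro span_scale span_base) simp
      qed (use x in \<open>simp_all add: span_0\<close>)
    qed
    finally show ?thesis using x by blast
  qed
  ultimately have "generalized_hyperbolic_tetrahedron v"
    unfolding generalized_hyperbolic_tetrahedron_def
    using lorentz_dual_inj[OF uv nz] lorentz_dual_independent[OF uv nz] by blast
  moreover have "outward_normal v i = u i" for i
    using uv c_pos unit by (rule outward_normal_eqI)
  ultimately show thesis using that by blast
qed

section \<open>Gram matrices of Lorentz bases and their signature\<close>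

lemma lorentz_sum: "lorentz x y = (\<Sum>k\<in>UNIV. (if k = 4 then -1 else 1) * (x $ k * y $ k))"
  by (simp add: lorentz_def sum_4)

text \<open>The map \<open>L\<close> carries the quadratic form of \<open>A\<close> to the Lorentz
  form. Nondegeneracy excludes the eigenvalue 0, the hyperplane of time coordinate 0 allows at most
  one negative eigenvalue, and the timelike axis requires one.\<close>

lemma signature_lorentz_gram:
  fixes A :: "real^4^4"
  assumes dual: "\<And>i j. lorentz (u i) (v j) = (if i = j then - c i else 0)"
    and pos: "\<And>i. 0 < c i"
    and gram: "\<And>i j. A $ i $ j = lorentz (u i) (u j)"
  shows "signature A = (3, 1)"
proof -
  have sym: "transpose A = A"
    by (simp add: vec_eq_iff transpose_def gram lorentz_commute)
  obtain p :: "4 \<Rightarrow> real^4" and d where pd: "\<forall>i j. p i \<bullet> p j = (if i = j then 1 else 0)"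
    "\<forall>i. A *v p i = d i *\<^sub>R p i"
    using symmetric_matrix_eigenbasis[OF sym] by (elim exE conjE) (rule that)
  note p = pd(1)[rule_format] and eig = pd(2)[rule_format]
  define L where "L a = (\<Sum>i\<in>UNIV. (a $ i) *\<^sub>R u i)" for a :: "real^4"
  have form: "lorentz (L a) (L b) = a \<bullet> (A *v b)" for a b
  proof -
    have "lorentz (L a) (L b) = (\<Sum>j\<in>UNIV. b $ j * lorentz (u j) (L a))"
      by (subst (2) L_def) (simp add: lorentz_sum_right lorentz_commute)
    also have "\<dots> = (\<Sum>j\<in>UNIV. \<Sum>i\<in>UNIV. b $ j * (a $ i * A $ i $ j))"
      by (simp add: L_def lorentz_sum_right sum_distrib_left gram lorentz_commute)
    also have "\<dots> = (\<Sum>i\<in>UNIV. \<Sum>j\<in>UNIV. b $ j * (a $ i * A $ i $ j))"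
      by (rule sum.swap)
    also have "\<dots> = a \<bullet> (A *v b)"
      by (simp add: inner_vec_def matrix_vector_mult_def sum_distrib_left mult_ac)
    finally show ?thesis .
  qed
  have dual': "lorentz (v j) (u i) = (if j = i then - c j else 0)" for i j
    using dual[of i j] by (auto simp: lorentz_commute)
  have nz: "- c i \<noteq> 0" for i using pos[of i] by simp
  have L_surj: "\<exists>a. L a = x" for x
  proof
    show "L (\<chi> i. lorentz (v i) x / - c i) = x"
      unfolding L_def using lorentz_dual_expansion[OF dual' nz, of x] by simp
  qed
  have L_scale: "L (s *\<^sub>R a - t *\<^sub>R b) = s *\<^sub>R L a - t *\<^sub>R L b" for s t a b
    by (simp add: L_def scaleR_sum_right scaleR_left_diff_distrib sum_subtractf)
  have eig_form: "lorentz (L a) (L (p k)) = d k * (a \<bullet> p k)" for a k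
    by (simp add: form eig)
  have nonzero: "d k \<noteq> 0" for k
  proof
    assume "d k = 0"
    then have "lorentz x (L (p k)) = 0" for x
      using L_surj[of x] eig_form by auto
    then have L0: "L (p k) = (\<Sum>i\<in>UNIV. (0::real) *\<^sub>R u i)"
      using lorentz_dual_expansion[OF dual' nz, of "L (p k)"] by simp
    have "p k $ i * - c i = 0" for i
    proof -
      have "lorentz (v i) (L (p k)) = p k $ i * - c i"
        by (simp add: L_def lorentz_sum_right dual' if_distrib cong: if_cong)
      with L0 show ?thesis by simp
    qed
    then have "p k = 0" using nz by (simp add: vec_eq_iff)
    then show False using p[of k k] by simp
  qed
  have spacelike: "0 \<le> lorentz x x" if "x $ 4 = 0" for x
    using that by (simp add: lorentz_def)
  \<comment> \<open>Two negative eigenvectors would span a negative definite plane, which meets the spacelike hyperplane \<open>x $ 4 = 0\<close>.\<close>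
  have neg_unique: "k = l" if neg: "d k < 0" "d l < 0" for k l
  proof (rule ccontr)
    assume "k \<noteq> l"
    \<comment> \<open>The crossed coefficients make the time coordinates cancel in
      \<open>L a\<close>.\<close>
    define s t where "s = L (p l) $ 4" and "t = L (p k) $ 4"
    define a where "a = s *\<^sub>R p k - t *\<^sub>R p l"
    have La: "L a = s *\<^sub>R L (p k) - t *\<^sub>R L (p l)" by (simp add: a_def L_scale)
    have "0 \<le> lorentz (L a) (L a)"
      by (rule spacelike) (simp add: La s_def t_def)
    also have "\<dots> = s\<^sup>2 * d k + t\<^sup>2 * d l"
      using \<open>k \<noteq> l\<close> by (simp add: La eig_form p power2_eq_square)
    finally have "0 \<le> s\<^sup>2 * d k + t\<^sup>2 * d l" .
    moreover have "s\<^sup>2 * d k \<le> 0" "t\<^sup>2 * d l \<le> 0" using neg by (simp_all add: mult_nonneg_nonpos)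
    ultimately have "s\<^sup>2 * d k = 0" by linarith
    then have "s = 0" using neg by simp
    \<comment> \<open>Now \<open>L (p l)\<close> itself has time coordinate 0, although its square
      is the negative number \<open>d l\<close>.\<close>
    then have "0 \<le> lorentz (L (p l)) (L (p l))" by (intro spacelike) (simp add: s_def)
    then show False using neg by (simp add: eig_form p)
  qed
  have "\<exists>k. d k < 0"
  proof (rule ccontr)
    assume "\<not> (\<exists>k. d k < 0)"
    then have d_nonneg: "0 \<le> d k" for k by (simp add: not_less)
    \<comment> \<open>With only nonnegative eigenvalues the form of this preimage would be a
      nonnegative weighted sum of squares, yet the axis has form -1.\<close>
    obtain a where a: "L a = axis 4 1" using L_surj by blast
    have pp: "(\<Sum>k\<in>UNIV. p k $ i * p k $ j) = (if i = j then 1 else 0)" for i j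
      using p by (rule orthonormal_rows_columns)
    have "a = (\<Sum>k\<in>UNIV. (a \<bullet> p k) *\<^sub>R p k)"
    proof -
      have "(\<Sum>k\<in>UNIV. (a \<bullet> p k) * p k $ j) = a $ j" for j
      proof -
        have "(\<Sum>k\<in>UNIV. (a \<bullet> p k) * p k $ j) = (\<Sum>k\<in>UNIV. \<Sum>i\<in>UNIV. a $ i * (p k $ i * p k $ j))"
          by (simp add: inner_vec_def sum_distrib_right mult.assoc)
        also have "\<dots> = (\<Sum>i\<in>UNIV. \<Sum>k\<in>UNIV. a $ i * (p k $ i * p k $ j))"
          by (rule sum.swap)
        also have "\<dots> = a $ j"
          by (simp add: sum_distrib_left[symmetric] pp if_distrib cong: if_cong)
        finally show ?thesis .
      qed
      then show ?thesis by (simp add: vec_eq_iff)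
    qed
    then have "A *v a = (\<Sum>k\<in>UNIV. (a \<bullet> p k) *\<^sub>R (d k *\<^sub>R p k))"
      by (metis (no_types, lifting) eig matrix_vector_mult_scaleR sum.cong linear_sum matrix_vector_mul_linear)
    then have "lorentz (L a) (L a) = (\<Sum>k\<in>UNIV. d k * (a \<bullet> p k)\<^sup>2)"
      by (simp add: form inner_sum_right power2_eq_square mult_ac)
    also have "\<dots> \<ge> 0" using d_nonneg by (intro sum_nonneg) simp
    finally show False by (simp add: a lorentz_def axis_def)
  qed
  then obtain k where "d k < 0" by blast
  then have neg: "{i. d i < 0} = {k}" using neg_unique by blast
  moreover have "{i. 0 < d i} = - {k}"
  proof (rule set_eqI)
    fix i
    have "d i < 0 \<longleftrightarrow> i = k" using neg by blast
    then show "i \<in> {i. 0 < d i} \<longleftrightarrow> i \<in> - {k}" using nonzero[of i] by auto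
  qed
  ultimately show ?thesis
    using signature_eigenbasis[OF p eig] by (simp add: Compl_eq_Diff_UNIV card_Diff_singleton)
qed

text \<open>The spectral decomposition writes \<open>A\<close> as a signed sum of squares. Scaling
  eigenvector coordinates by the roots of the absolute eigenvalues turns it into the Lorentz form;
  dividing by the same roots gives the dual basis.\<close>

lemma exists_lorentz_gram:
  fixes A :: "real^4^4"
  assumes sym: "transpose A = A" and sig: "signature A = (3, 1)"
  shows "\<exists>u w. (\<forall>i j. lorentz (u i) (u j) = A $ i $ j) \<and>
    (\<forall>i j. lorentz (w i) (u j) = (if i = j then -1 else 0))"
proof -
  obtain p :: "4 \<Rightarrow> real^4" and d where pd: "\<forall>i j. p i \<bullet> p j = (if i = j then 1 else 0)"
    "\<forall>i. A *v p i = d i *\<^sub>R p i"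
    using symmetric_matrix_eigenbasis[OF sym] by (elim exE conjE) (rule that)
  note p = pd(1)[rule_format] and eig = pd(2)[rule_format]
  have pp: "(\<Sum>k\<in>UNIV. p k $ i * p k $ j) = (if i = j then 1 else 0)" for i j
    using p by (rule orthonormal_rows_columns)
  have A: "A $ i $ j = (\<Sum>k\<in>UNIV. d k * (p k $ i * p k $ j))" for i j
  proof -
    have "A $ i $ j = (\<Sum>m\<in>UNIV. A $ i $ m * (\<Sum>k\<in>UNIV. p k $ m * p k $ j))"
      by (simp add: pp if_distrib cong: if_cong)
    also have "\<dots> = (\<Sum>k\<in>UNIV. \<Sum>m\<in>UNIV. A $ i $ m * (p k $ m * p k $ j))"
      unfolding sum_distrib_left by (rule sum.swap)
    also have "\<dots> = (\<Sum>k\<in>UNIV. (A *v p k) $ i * p k $ j)"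
      by (simp add: matrix_vector_mult_def sum_distrib_right mult.assoc)
    finally show ?thesis by (simp add: eig mult.assoc)
  qed
  have cards: "card {i. 0 < d i} = 3" "card {i. d i < 0} = 1"
    using sig signature_eigenbasis[OF p eig] by simp_all
  then obtain k0 where k0: "{i. d i < 0} = {k0}" by (metis card_1_singletonE)
  have "{i. 0 < d i} = - {k0}"
    using k0 cards(1) by (intro card_subset_eq) (auto simp: Compl_eq_Diff_UNIV card_Diff_singleton)
  then have d_sign: "d k0 < 0" "k \<noteq> k0 \<Longrightarrow> 0 < d k" for k
    using k0 by auto
  \<comment> \<open>The transposition of \<open>4\<close> and \<open>k0\<close> moves the negative
    eigenvalue to the time coordinate; it is the identity if \<open>k0\<close> is
    \<open>4\<close>.\<close>
  define \<tau> where "\<tau> k = (if k = 4 then k0 else if k = k0 then 4 else k)" for k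
  have \<tau>: "bij \<tau>"
    by (rule involuntory_imp_bij) (simp add: \<tau>_def)
  have \<tau>_iff: "\<tau> k = k0 \<longleftrightarrow> k = 4" for k by (auto simp: \<tau>_def)
  define s where "s k = sqrt \<bar>d (\<tau> k)\<bar>" for k
  have s_nz: "s k \<noteq> 0" for k
    using d_sign(1) d_sign(2)[of "\<tau> k"] by (cases "\<tau> k = k0") (auto simp: s_def)
  have s_sq: "(if k = 4 then -1 else 1) * (s k * s k) = d (\<tau> k)" for k
    using d_sign(1) d_sign(2)[of "\<tau> k"] \<tau>_iff[of k] by (cases "\<tau> k = k0") (auto simp: s_def)
  define u where "u i = (\<chi> k. s k * p (\<tau> k) $ i)" for i
  \<comment> \<open>The signs are opposite to those of the form, so every summand of the pairing
    carries a minus sign.\<close>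
  define w :: "4 \<Rightarrow> real^4" where "w i = (\<chi> k. (if k = 4 then 1 else -1) * (p (\<tau> k) $ i / s k))" for i
  have "lorentz (u i) (u j) = A $ i $ j" for i j
  proof -
    have "lorentz (u i) (u j) =
        (\<Sum>k\<in>UNIV. ((if k = 4 then -1 else 1) * (s k * s k)) * (p (\<tau> k) $ i * p (\<tau> k) $ j))"
      unfolding lorentz_sum by (intro sum.cong) (simp_all add: u_def)
    also have "\<dots> = (\<Sum>k\<in>UNIV. d (\<tau> k) * (p (\<tau> k) $ i * p (\<tau> k) $ j))"
      by (simp only: s_sq)
    also have "\<dots> = (\<Sum>k\<in>UNIV. d k * (p k $ i * p k $ j))"
      using \<tau> by (rule sum.reindex_bij_betw)
    finally show ?thesis by (simp only: A)
  qed
  moreover have "lorentz (w i) (u j) = (if i = j then -1 else 0)" for i j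
  proof -
    have "lorentz (w i) (u j) = (\<Sum>k\<in>UNIV. - (p (\<tau> k) $ i * p (\<tau> k) $ j))"
      unfolding lorentz_sum using s_nz by (intro sum.cong) (simp_all add: u_def w_def)
    also have "\<dots> = - (\<Sum>k\<in>UNIV. p k $ i * p k $ j)"
      unfolding sum_negf using sum.reindex_bij_betw[OF \<tau>, of "\<lambda>k. p k $ i * p k $ j"] by simp
    finally show ?thesis by (simp add: pp)
  qed
  ultimately show ?thesis by (intro exI[of _ u] exI[of _ w]) simp
qed

section \<open>Dihedral angles in terms of the normals\<close>

theorem theorem3p7:
  fixes \<theta> :: "4 \<Rightarrow> 4 \<Rightarrow> real"
  assumes angle_sym: "\<And>i j. \<theta> i j = \<theta> j i"
    and angle_range: "\<And>i j. i \<noteq> j \<Longrightarrow> 0 \<le> \<theta> i j \<and> \<theta> i j \<le> pi"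
  shows "(\<exists>v. generalized_hyperbolic_tetrahedron v \<and>
             (\<forall>i j. i \<noteq> j \<longrightarrow> dihedral_angle v i j = \<theta> i j))
         \<longleftrightarrow> signature (gram_matrix \<theta>) = (3, 1)"
proof
  assume "\<exists>v. generalized_hyperbolic_tetrahedron v \<and>
             (\<forall>i j. i \<noteq> j \<longrightarrow> dihedral_angle v i j = \<theta> i j)"
  then obtain v where v: "generalized_hyperbolic_tetrahedron v"
    and angles: "\<And>i j. i \<noteq> j \<Longrightarrow> dihedral_angle v i j = \<theta> i j" by blast
  obtain u c where uc: "\<forall>i j. lorentz (u i) (v j) = (if i = j then - c i else 0)"
    "\<forall>i. 0 < c i" "\<forall>i. lorentz (u i) (u i) = 1"
    "\<forall>i j. i \<noteq> j \<longrightarrow> \<bar>lorentz (u i) (u j)\<bar> \<le> 1"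
    using tetrahedron_normals[OF v] by (elim exE conjE) (rule that)
  note dual = uc(1)[rule_format] and pos = uc(2)[rule_format] and unit = uc(3)[rule_format]
    and le_1 = uc(4)[rule_format]
  have normal: "outward_normal v i = u i" for i
    using dual pos unit by (rule outward_normal_eqI)
  have "gram_matrix \<theta> $ i $ j = lorentz (u i) (u j)" for i j
  proof (cases "i = j")
    case False
    have "\<theta> i j = pi - arccos (lorentz (u i) (u j))"
      using angles[OF False] by (simp add: dihedral_angle_def normal)
    then have "- cos (\<theta> i j) = cos (arccos (lorentz (u i) (u j)))"
      by (simp add: cos_diff)
    \<comment> \<open>The bound on the product is what makes \<open>cos\<close> undo
      \<open>arccos\<close>.\<close>
    with False show ?thesis using le_1[OF False] by (simp add: gram_matrix_def cos_arccos_abs)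
  qed (simp add: gram_matrix_def unit)
  with dual pos show "signature (gram_matrix \<theta>) = (3, 1)"
    by (rule signature_lorentz_gram)
next
  assume sig: "signature (gram_matrix \<theta>) = (3, 1)"
  have sym: "transpose (gram_matrix \<theta>) = gram_matrix \<theta>"
    using angle_sym by (simp add: vec_eq_iff transpose_def gram_matrix_def)
  obtain u w where uw: "\<forall>i j. lorentz (u i) (u j) = gram_matrix \<theta> $ i $ j"
    "\<forall>i j. lorentz (w i) (u j) = (if i = j then -1 else 0)"
    using exists_lorentz_gram[OF sym sig] by (elim exE conjE) (rule that)
  note gram = uw(1)[rule_format] and dual = uw(2)[rule_format]
  have unit: "lorentz (u i) (u i) = 1" for i
    by (simp add: gram gram_matrix_def)
  have gram_off: "lorentz (u i) (u j) = - cos (\<theta> i j)" if "i \<noteq> j" for i j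
    using that by (simp add: gram gram_matrix_def)
  then have le_1: "\<bar>lorentz (u i) (u j)\<bar> \<le> 1" if "i \<noteq> j" for i j
    using that by simp
  obtain v where v: "generalized_hyperbolic_tetrahedron v"
    and normal: "\<And>i. outward_normal v i = u i"
    by (rule tetrahedron_of_normals[OF dual unit]) (erule le_1, rule that)
  have "dihedral_angle v i j = \<theta> i j" if "i \<noteq> j" for i j
  proof -
    \<comment> \<open>The range of the angles puts \<open>pi - \<theta> i j\<close> between 0 and
      \<open>pi\<close>, where \<open>arccos\<close> inverts \<open>cos\<close>.\<close>
    have "arccos (cos (pi - \<theta> i j)) = pi - \<theta> i j"
      using angle_range[OF that] by (intro arccos_cos) auto
    then show ?thesis
      using gram_off[OF that] by (simp add: dihedral_angle_def normal cos_diff)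
  qed
  with v show "\<exists>v. generalized_hyperbolic_tetrahedron v \<and>
             (\<forall>i j. i \<noteq> j \<longrightarrow> dihedral_angle v i j = \<theta> i j)" by blast
qed

end
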